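(* Let $\upsilon\in\{1,2,\dots\}$, $q>-1$, and let $k,s$ be nonnegative integers. Then $$\lim_{p\to\infty}\left(p^{-\frac{k}{2}}\;{}_{K}I_{k;\upsilon}^{(p,q)}\left(\frac{z}{\sqrt p},t\right)\right)={}_{\upsilon}H_{k}^{(q)}(z,t)$$ and $$\lim_{p\to\infty}\left(p^{-\frac{s}{2}}\;{}_{K}\mathcal{I}_{s;\upsilon}^{(p,q)}\left(\frac{z}{\sqrt p},t\right)\right)={}_{\upsilon}Q_{s}^{(q)}(z,t).$$
   Context: $(a)_n$ is the Pochhammer symbol, $[x]$ the integer part. $${}_{K}I_{k;\upsilon}^{(p,q)}(z,t)=(-1)^{k}(1-p)_{k}\sum_{l=0}^{[k/2]}\sum_{n=0}^{k-l}\frac{(-1)^{l}(-k)_{2l}(l-k)_{n}(2z)^{k-2l}t^{\upsilon n}}{(p-k)_{l}\,\Gamma(\upsilon n+q+1)\,n!\,l!}\qquad(p>k+1),$$ $${}_{K}\mathcal{I}_{s;\upsilon}^{(p,q)}(z,t)=I_{s}^{(p)}(z)\sum_{j=0}^{s}Y_{j}^{(q)}(t;\upsilon),\qquad I_{s}^{(p)}(z)=s!\sum_{l=0}^{[s/2]}\frac{(-1)^{l}\Gamma(p)(2z)^{s-2l}}{l!\,(s-2l)!\,\Gamma(p-s+l)},$$ $$Y_{j}^{(q)}(t;\upsilon)=\frac{1}{j!}\sum_{r=0}^{j}\frac{t^{r}}{r!}\sum_{m=0}^{r}(-1)^{m}\binom{r}{m}\left(\frac{1+q+m}{\upsilon}\right)_{j}.$$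 The pair of Hermite-Konhauser polynomials is $${}_{\upsilon}H_{k}^{(q)}(z,t)=\sum_{l=0}^{[k/2]}\sum_{n=0}^{k-l}\frac{(-1)^{l}(-k)_{2l}(-k)_{l+n}(2z)^{k-2l}t^{\upsilon n}}{(-k)_{l}\,\Gamma(\upsilon n+q+1)\,l!\,n!},\qquad {}_{\upsilon}Q_{s}^{(q)}(z,t)=H_{s}(z)\sum_{j=0}^{s}Y_{j}^{(q)}(t;\upsilon),$$ with $H_s$ the classical (physicists') Hermite polynomials $H_s(z)=s!\sum_{l=0}^{[s/2]}\frac{(-1)^l(2z)^{s-2l}}{l!(s-2l)!}$. *)

theory Defs
  imports "HOL-Analysis.Analysis"
begin

text \<open>
  The variables \<open>z\<close>, \<open>t\<close> and the parameters \<open>p\<close>, \<open>q\<close> are real; \<open>\<upsilon>\<close> and the degrees are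
  natural numbers. The defining formulas are written down for all real \<open>p\<close>, but they are
  meant for large \<open>p\<close> only (\<open>p > k + 1\<close>): there no denominator vanishes and
  \<open>Gamma\<close> is evaluated away from its poles, where the library sets it to \<open>0\<close>.
\<close>

definition KI :: "nat \<Rightarrow> nat \<Rightarrow> real \<Rightarrow> real \<Rightarrow> real \<Rightarrow> real \<Rightarrow> real" where
  "KI k \<upsilon> p q z t =
     (-1) ^ k * pochhammer (1 - p) k *
     (\<Sum>l=0..k div 2. \<Sum>n=0..k - l.
        ((-1) ^ l * pochhammer (- real k) (2 * l) * pochhammer (real l - real k) n
           * (2 * z) ^ (k - 2 * l) * t ^ (\<upsilon> * n)) /
        (pochhammer (p - real k) l * Gamma (real (\<upsilon> * n) + q + 1) * fact n * fact l))"

definition finite_I :: "nat \<Rightarrow> real \<Rightarrow> real \<Rightarrow> real" where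
  "finite_I s p z =
     fact s * (\<Sum>l=0..s div 2.
        ((-1) ^ l * Gamma p * (2 * z) ^ (s - 2 * l)) /
        (fact l * fact (s - 2 * l) * Gamma (p - real s + real l)))"

definition konhauser_Y :: "nat \<Rightarrow> real \<Rightarrow> real \<Rightarrow> nat \<Rightarrow> real" where
  "konhauser_Y j q t \<upsilon> =
     1 / fact j * (\<Sum>r=0..j. t ^ r / fact r *
        (\<Sum>m=0..r. (-1) ^ m * real (r choose m) * pochhammer ((1 + q + real m) / real \<upsilon>) j))"

definition KI_cal :: "nat \<Rightarrow> nat \<Rightarrow> real \<Rightarrow> real \<Rightarrow> real \<Rightarrow> real \<Rightarrow> real" where
  "KI_cal s \<upsilon> p q z t = finite_I s p z * (\<Sum>j=0..s. konhauser_Y j q t \<upsilon>)"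

definition hermite_konhauser_H :: "nat \<Rightarrow> nat \<Rightarrow> real \<Rightarrow> real \<Rightarrow> real \<Rightarrow> real" where
  "hermite_konhauser_H \<upsilon> k q z t =
     (\<Sum>l=0..k div 2. \<Sum>n=0..k - l.
        ((-1) ^ l * pochhammer (- real k) (2 * l) * pochhammer (- real k) (l + n)
           * (2 * z) ^ (k - 2 * l) * t ^ (\<upsilon> * n)) /
        (pochhammer (- real k) l * Gamma (real (\<upsilon> * n) + q + 1) * fact l * fact n))"

text \<open>Physicists' normalisation.\<close>

definition hermite :: "nat \<Rightarrow> real \<Rightarrow> real" where
  "hermite s z =
     fact s * (\<Sum>l=0..s div 2.
        ((-1) ^ l * (2 * z) ^ (s - 2 * l)) / (fact l * fact (s - 2 * l)))"

definition hermite_konhauser_Q :: "nat \<Rightarrow> nat \<Rightarrow> real \<Rightarrow> real \<Rightarrow> real \<Rightarrow> real" where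
  "hermite_konhauser_Q \<upsilon> s q z t = hermite s z * (\<Sum>j=0..s. konhauser_Y j q t \<upsilon>)"

end

theory Submission
  imports Defs
begin

text \<open>
  Both limits hold term by term, for the same reason. In each finite family the parameter \<open>p\<close>
  enters the \<open>l\<close>-th term only through a quotient that collapses to the single shifted factorial
  \<open>(p - k + l)\<^sub>k\<^sub>-\<^sub>l\<close>: in the first family it is \<open>(-1)\<^sup>k (1 - p)\<^sub>k / (p - k)\<^sub>l\<close>, because reflection
  turns the numerator into \<open>(p - k)\<^sub>k\<close>, and in the second it is \<open>\<Gamma>(p) / \<Gamma>(p - s + l)\<close>, by the
  functional equation of \<open>\<Gamma>\<close> (lemmas \<open>reflected_pochhammer_quotient\<close> and \<open>Gamma_quotient\<close>).

  This shifted factorial is a monic polynomial in \<open>p\<close> of degree \<open>k - l\<close>, hence asymptotic to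
  \<open>p\<^sup>k\<^sup>-\<^sup>l\<close>. Replacing \<open>z\<close> by \<open>z / \<surd>p\<close> in \<open>(2z)\<close> to the power \<open>k - 2l\<close> and multiplying by
  \<open>p\<close> to the power \<open>-k/2\<close> contributes exactly the power \<open>-(k - l)\<close> of \<open>p\<close>, so the growth cancels
  in every term simultaneously and \<open>(2z)\<close> to the power \<open>k - 2l\<close> is left
  (lemma \<open>tendsto_rescaled_term\<close>). What remains in the first family is the Hermite-Konhauser
  coefficient, since \<open>(-k)\<^sub>l\<^sub>+\<^sub>n = (-k)\<^sub>l (l - k)\<^sub>n\<close>; in the second it is the Hermite coefficient,
  while the Konhauser factor does not involve \<open>p\<close> at all.
\<close>

lemma pochhammer_asymp_power:
  fixes a :: real
  shows "((\<lambda>p. pochhammer (p + a) n / p ^ n) \<longlongrightarrow> 1) at_top"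
proof (induction n)
  case 0
  show ?case by simp
next
  case (Suc n)
  have "((\<lambda>p::real. 1 + (a + real n) / p) \<longlongrightarrow> 1 + 0) at_top"
    by (intro tendsto_add tendsto_const tendsto_divide_0[OF tendsto_const]
              filterlim_at_top_imp_at_infinity filterlim_ident)
  from tendsto_mult[OF Suc.IH this]
  have "((\<lambda>p. pochhammer (p + a) n / p ^ n * (1 + (a + real n) / p)) \<longlongrightarrow> 1) at_top"
    by simp
  then show ?case
    by (rule Lim_transform_eventually)
       (use eventually_gt_at_top[of "0::real"] in
         \<open>eventually_elim, simp add: pochhammer_Suc field_simps\<close>)
qed

text \<open>
  The reflection \<open>(-1)\<^sup>k (1 - p)\<^sub>k = (p - k)\<^sub>k\<close> makes the denominator an initial segment of the
  product in the numerator.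
\<close>

lemma reflected_pochhammer_quotient:
  fixes p :: real
  assumes "l \<le> k" and "p > real k"
  shows "(-1) ^ k * pochhammer (1 - p) k / pochhammer (p - real k) l
           = pochhammer (p - real k + real l) (k - l)"
proof -
  have "(-1) ^ k * pochhammer (1 - p) k = pochhammer (p - real k) k"
    using pochhammer_minus[of "p - 1" k] by (simp flip: power_mult_distrib mult.assoc)
  also have "\<dots> = pochhammer (p - real k) l * pochhammer (p - real k + real l) (k - l)"
    using assms(1) by (rule pochhammer_product)
  finally show ?thesis
    using pochhammer_pos[of "p - real k" l] assms(2) by simp
qed

lemma Gamma_quotient:
  fixes p :: real
  assumes "l \<le> s" and "p > real s"
  shows "Gamma p / Gamma (p - real s + real l) = pochhammer (p - real s + real l) (s - l)"
proof -
  have "p - real s + real l \<notin> \<int>\<^sub>\<le>\<^sub>0"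
    using assms by (auto elim!: nonpos_Ints_cases)
  from pochhammer_Gamma[OF this, of "s - l"] show ?thesis
    using assms(1) by (simp add: of_nat_diff)
qed

text \<open>
  The exponents of \<open>\<surd>p\<close> balance: \<open>-k\<close> from the prefactor, \<open>-(k - 2l)\<close> from the rescaled argument
  and \<open>2(k - l)\<close> from the shifted factorial.
\<close>

lemma tendsto_rescaled_term:
  fixes z :: real
  assumes "2 * l \<le> k"
  shows "((\<lambda>p. p powr (- (real k / 2)) *
            (pochhammer (p - real k + real l) (k - l) * (2 * (z / sqrt p)) ^ (k - 2 * l)))
          \<longlongrightarrow> (2 * z) ^ (k - 2 * l)) at_top"
proof -
  have "((\<lambda>p. pochhammer (p + (real l - real k)) (k - l) / p ^ (k - l) * (2 * z) ^ (k - 2 * l))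
          \<longlongrightarrow> 1 * (2 * z) ^ (k - 2 * l)) at_top"
    by (intro tendsto_mult pochhammer_asymp_power tendsto_const)
  then have "((\<lambda>p. pochhammer (p - real k + real l) (k - l) / p ^ (k - l) * (2 * z) ^ (k - 2 * l))
          \<longlongrightarrow> (2 * z) ^ (k - 2 * l)) at_top"
    by (simp add: algebra_simps)
  then show ?thesis
  proof (rule Lim_transform_eventually)
    show "\<forall>\<^sub>F p in at_top.
      pochhammer (p - real k + real l) (k - l) / p ^ (k - l) * (2 * z) ^ (k - 2 * l) =
      p powr (- (real k / 2)) *
        (pochhammer (p - real k + real l) (k - l) * (2 * (z / sqrt p)) ^ (k - 2 * l))"
      using eventually_gt_at_top[of "0::real"]
    proof eventually_elim
      case (elim p)
      have "p powr (real k / 2) = sqrt p ^ k"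
        using elim by (simp add: powr_half_sqrt_powr powr_realpow real_sqrt_power)
      then have prefactor: "p powr (- (real k / 2)) = 1 / sqrt p ^ k"
        by (simp add: powr_minus_divide)
      have "p ^ (k - l) = (sqrt p ^ 2) ^ (k - l)"
        using elim by simp
      also have "\<dots> = sqrt p ^ (k + (k - 2 * l))"
      proof -
        have "2 * (k - l) = k + (k - 2 * l)"
          using assms by simp
        then show ?thesis
          by (simp only: power_mult [symmetric])
      qed
      also have "\<dots> = sqrt p ^ k * sqrt p ^ (k - 2 * l)"
        by (rule power_add)
      finally show ?case
        by (simp add: prefactor power_divide power_mult_distrib)
    qed
  qed
qed

lemma tendsto_KI_rescaled:
  "((\<lambda>p. p powr (- (real k / 2)) * KI k \<upsilon> p q (z / sqrt p) t)
     \<longlongrightarrow> hermite_konhauser_H \<upsilon> k q z t) at_top"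
proof -
  define c where "c l n = (-1) ^ l * pochhammer (- real k) (2 * l) * pochhammer (real l - real k) n
      * t ^ (\<upsilon> * n) / (Gamma (real (\<upsilon> * n) + q + 1) * fact n * fact l)" for l n
  let ?w = "\<lambda>p l. p powr (- (real k / 2)) *
      (pochhammer (p - real k + real l) (k - l) * (2 * (z / sqrt p)) ^ (k - 2 * l))"
  have "((\<lambda>p. \<Sum>l=0..k div 2. \<Sum>n=0..k - l. c l n * ?w p l)
      \<longlongrightarrow> (\<Sum>l=0..k div 2. \<Sum>n=0..k - l. c l n * (2 * z) ^ (k - 2 * l))) at_top"
    by (intro tendsto_sum tendsto_mult_left tendsto_rescaled_term) auto
  also have "(\<Sum>l=0..k div 2. \<Sum>n=0..k - l. c l n * (2 * z) ^ (k - 2 * l))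
      = hermite_konhauser_H \<upsilon> k q z t"
    unfolding hermite_konhauser_H_def
  proof (intro sum.cong refl)
    fix l n assume "l \<in> {0..k div 2}"
    \<comment> \<open>The zeros of \<open>(-k)\<^sub>l\<close> start only at \<open>l = k + 1\<close>, so it can be cancelled.\<close>
    then have "pochhammer (- real k) l \<noteq> 0"
      by (auto simp: pochhammer_eq_0_iff)
    moreover have "pochhammer (- real k) (l + n)
        = pochhammer (- real k) l * pochhammer (real l - real k) n"
      using pochhammer_product'[of "- real k" l n] by simp
    ultimately show "c l n * (2 * z) ^ (k - 2 * l) =
      (-1) ^ l * pochhammer (- real k) (2 * l) * pochhammer (- real k) (l + n)
        * (2 * z) ^ (k - 2 * l) * t ^ (\<upsilon> * n) /
      (pochhammer (- real k) l * Gamma (real (\<upsilon> * n) + q + 1) * fact l * fact n)"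
      by (simp add: c_def mult_ac)
  qed
  finally show ?thesis
  proof (rule Lim_transform_eventually)
    show "\<forall>\<^sub>F p in at_top. (\<Sum>l=0..k div 2. \<Sum>n=0..k - l. c l n * ?w p l)
        = p powr (- (real k / 2)) * KI k \<upsilon> p q (z / sqrt p) t"
      using eventually_gt_at_top[of "real k"]
    proof eventually_elim
      case (elim p)
      show ?case
        unfolding KI_def sum_distrib_left
      proof (intro sum.cong refl)
        fix l n assume "l \<in> {0..k div 2}"
        then have "l \<le> k" by auto
        from reflected_pochhammer_quotient[OF this elim, symmetric]
        show "c l n * ?w p l = p powr (- (real k / 2)) * ((-1) ^ k * pochhammer (1 - p) k *
          ((-1) ^ l * pochhammer (- real k) (2 * l) * pochhammer (real l - real k) n
            * (2 * (z / sqrt p)) ^ (k - 2 * l) * t ^ (\<upsilon> * n) /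
          (pochhammer (p - real k) l * Gamma (real (\<upsilon> * n) + q + 1) * fact n * fact l)))"
          by (simp add: c_def mult_ac)
      qed
    qed
  qed
qed

lemma tendsto_finite_I_rescaled:
  "((\<lambda>p. p powr (- (real s / 2)) * finite_I s p (z / sqrt p)) \<longlongrightarrow> hermite s z) at_top"
proof -
  define c :: "nat \<Rightarrow> real" where "c l = fact s * (-1) ^ l / (fact l * fact (s - 2 * l))" for l
  let ?w = "\<lambda>p l. p powr (- (real s / 2)) *
      (pochhammer (p - real s + real l) (s - l) * (2 * (z / sqrt p)) ^ (s - 2 * l))"
  have "((\<lambda>p. \<Sum>l=0..s div 2. c l * ?w p l)
      \<longlongrightarrow> (\<Sum>l=0..s div 2. c l * (2 * z) ^ (s - 2 * l))) at_top"
    by (intro tendsto_sum tendsto_mult_left tendsto_rescaled_term) auto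
  also have "(\<Sum>l=0..s div 2. c l * (2 * z) ^ (s - 2 * l)) = hermite s z"
    by (simp add: hermite_def c_def sum_distrib_left mult_ac)
  finally show ?thesis
  proof (rule Lim_transform_eventually)
    show "\<forall>\<^sub>F p in at_top. (\<Sum>l=0..s div 2. c l * ?w p l)
        = p powr (- (real s / 2)) * finite_I s p (z / sqrt p)"
      using eventually_gt_at_top[of "real s"]
    proof eventually_elim
      case (elim p)
      show ?case
        unfolding finite_I_def sum_distrib_left
      proof (intro sum.cong refl)
        fix l assume "l \<in> {0..s div 2}"
        then have "l \<le> s" by auto
        from Gamma_quotient[OF this elim, symmetric]
        show "c l * ?w p l = p powr (- (real s / 2)) * (fact s *
          ((-1) ^ l * Gamma p * (2 * (z / sqrt p)) ^ (s - 2 * l) /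
            (fact l * fact (s - 2 * l) * Gamma (p - real s + real l))))"
          by (simp add: c_def mult_ac)
      qed
    qed
  qed
qed

theorem theorem26:
  fixes \<upsilon> k s :: nat and q z t :: real
  assumes "\<upsilon> \<ge> 1" and "q > -1"
  shows "((\<lambda>p::real. p powr (- (real k / 2)) * KI k \<upsilon> p q (z / sqrt p) t)
            \<longlongrightarrow> hermite_konhauser_H \<upsilon> k q z t) at_top \<and>
         ((\<lambda>p::real. p powr (- (real s / 2)) * KI_cal s \<upsilon> p q (z / sqrt p) t)
            \<longlongrightarrow> hermite_konhauser_Q \<upsilon> s q z t) at_top"
proof
  show "((\<lambda>p. p powr (- (real k / 2)) * KI k \<upsilon> p q (z / sqrt p) t)
      \<longlongrightarrow> hermite_konhauser_H \<upsilon> k q z t) at_top"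
    by (rule tendsto_KI_rescaled)
  show "((\<lambda>p. p powr (- (real s / 2)) * KI_cal s \<upsilon> p q (z / sqrt p) t)
      \<longlongrightarrow> hermite_konhauser_Q \<upsilon> s q z t) at_top"
    using tendsto_mult_right[OF tendsto_finite_I_rescaled[of s z]]
    by (simp add: KI_cal_def hermite_konhauser_Q_def mult.assoc)
qed

end
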